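(* Let $m,n\ge 2$ with $m=2k$ even, and let $\mathcal{B}\in S_{m,n}$ have associated homogeneous polynomial $\mathcal{B}(\mathbf{x})=\sum_{|\alpha|=2k}b_\alpha\mathbf{x}^\alpha$. Let $M(\mathcal{B})$ be the symmetric matrix indexed by all multi-indices $\beta,\gamma\in\mathbb{N}^n$ with $|\beta|=|\gamma|=k$, with entries $M(\mathcal{B})_{\beta,\gamma}=b_{\beta+\gamma}$. Then $$\mathcal{B}\in SOS_{m,n}^*\iff M(\mathcal{B})\succeq 0 .$$
   Context: $S_{m,n}$ is the space of real symmetric tensors of order $m$ and dimension $n$; each $\mathcal{A}\in S_{m,n}$ is identified with its homogeneous polynomial of degree $m$, written in the unnormalized monomial basis (no multinomial coefficients) as $\mathcal{A}(\mathbf{x})=\sum_{|\alpha|=m}a_\alpha\mathbf{x}^\alpha$, where $\alpha=(\alpha_1,\dots,\alpha_n)\in\mathbb{N}^n$, $|\alpha|=\alpha_1+\cdots+\alpha_n$, $\mathbf{x}^\alpha=x_1^{\alpha_1}\cdots x_n^{\alpha_n}$. The inner product used here is $\mathcal{A}\bullet\mathcal{B}=\sum_{|\alpha|=m}a_\alpha b_\alpha$. $SOS_{m,n}$ ($m=2k$) is the cone of tensors whose polynomial is a finite sum of squares of real homogeneous polynomials of degree $k$. Its dual cone is $SOS_{m,n}^*=\{\mathcal{B}\in S_{m,n}:\mathcal{A}\bullet\mathcal{B}\ge 0\ \forall\mathcal{A}\in SOS_{m,n}\}$, with respect to this inner product. $M\succeq 0$ means $M$ is positive semidefinite. *)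

theory Defs
  imports Complex_Main "HOL-Library.Poly_Mapping" "HOL-Library.Multiset"
begin

text \<open>Real polynomials in variables indexed by \<open>nat\<close>; the product of
  \<open>\<Rightarrow>\<^sub>0\<close> is convolution, i.e. the usual product of polynomials. Dimension
  \<open>n\<close> means that only the variables with index in \<open>{..<n}\<close> occur.\<close>

type_synonym multi_index = "nat \<Rightarrow>\<^sub>0 nat"
type_synonym real_mpoly = "multi_index \<Rightarrow>\<^sub>0 real"

definition multi_indices :: "nat \<Rightarrow> nat \<Rightarrow> multi_index set" where
  "multi_indices n d = {\<alpha>. Poly_Mapping.keys \<alpha> \<subseteq> {..<n} \<and> (\<Sum>i<n. Poly_Mapping.lookup \<alpha> i) = d}"

definition homogeneous_poly :: "nat \<Rightarrow> nat \<Rightarrow> real_mpoly \<Rightarrow> bool" where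
  "homogeneous_poly n d p \<longleftrightarrow> Poly_Mapping.keys p \<subseteq> multi_indices n d"

text \<open>A tensor of order \<open>m\<close> and dimension \<open>n\<close> is a family of reals indexed by
  \<open>(i\<^sub>1, \<dots>, i\<^sub>m)\<close> with entries below \<open>n\<close>. It is represented by a function on lists
  that vanishes outside the index range, so that each tensor has exactly one representative.\<close>

type_synonym real_tensor = "nat list \<Rightarrow> real"

definition tensor_indices :: "nat \<Rightarrow> nat \<Rightarrow> nat list set" where
  "tensor_indices m n = {is. length is = m \<and> set is \<subseteq> {..<n}}"

definition sym_tensors :: "nat \<Rightarrow> nat \<Rightarrow> real_tensor set" where
  "sym_tensors m n = {A. (\<forall>is. is \<notin> tensor_indices m n \<longrightarrow> A is = 0) \<and>
     (\<forall>is\<in>tensor_indices m n. \<forall>js\<in>tensor_indices m n. mset is = mset js \<longrightarrow> A is = A js)}"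

text \<open>The polynomial
  \<open>\<Sum> A(i\<^sub>1, \<dots>, i\<^sub>m) x(i\<^sub>1) \<cdots> x(i\<^sub>m)\<close>, summed over all index tuples. Its coefficient
  at \<open>\<alpha>\<close> is \<open>a\<^sub>\<alpha>\<close> in the unnormalized monomial basis: the multinomial factor
  (the number of tuples with exponent \<open>\<alpha>\<close>) is part of \<open>a\<^sub>\<alpha>\<close>.\<close>

definition tensor_poly :: "nat \<Rightarrow> nat \<Rightarrow> real_tensor \<Rightarrow> real_mpoly" where
  "tensor_poly m n A =
     (\<Sum>is\<in>tensor_indices m n. Poly_Mapping.single (\<Sum>i\<leftarrow>is. Poly_Mapping.single i 1) (A is))"

definition tensor_coeff :: "nat \<Rightarrow> nat \<Rightarrow> real_tensor \<Rightarrow> multi_index \<Rightarrow> real" where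
  "tensor_coeff m n A \<alpha> = Poly_Mapping.lookup (tensor_poly m n A) \<alpha>"

text \<open>This is not the entrywise inner product of tensors.\<close>

definition tensor_inner :: "nat \<Rightarrow> nat \<Rightarrow> real_tensor \<Rightarrow> real_tensor \<Rightarrow> real" where
  "tensor_inner m n A B = (\<Sum>\<alpha>\<in>multi_indices n m. tensor_coeff m n A \<alpha> * tensor_coeff m n B \<alpha>)"

text \<open>The next two notions are meant for even \<open>m\<close>.\<close>

definition SOS :: "nat \<Rightarrow> nat \<Rightarrow> real_tensor set" where
  "SOS m n = {A \<in> sym_tensors m n. \<exists>qs :: real_mpoly list.
     (\<forall>q\<in>set qs. homogeneous_poly n (m div 2) q) \<and> tensor_poly m n A = (\<Sum>q\<leftarrow>qs. q\<^sup>2)}"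

definition SOS_dual :: "nat \<Rightarrow> nat \<Rightarrow> real_tensor set" where
  "SOS_dual m n = {B \<in> sym_tensors m n. \<forall>A\<in>SOS m n. tensor_inner m n A B \<ge> 0}"

definition moment_matrix :: "nat \<Rightarrow> nat \<Rightarrow> real_tensor \<Rightarrow> multi_index \<Rightarrow> multi_index \<Rightarrow> real" where
  "moment_matrix m n B \<beta> \<gamma> = tensor_coeff m n B (\<beta> + \<gamma>)"

text \<open>Real matrices with rows and columns indexed by a finite set \<open>I\<close>; entries outside
  \<open>I \<times> I\<close> are irrelevant.\<close>

definition psd_on :: "'i set \<Rightarrow> ('i \<Rightarrow> 'i \<Rightarrow> real) \<Rightarrow> bool" where
  "psd_on I M \<longleftrightarrow> (\<forall>i\<in>I. \<forall>j\<in>I. M i j = M j i) \<and>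
     (\<forall>v :: 'i \<Rightarrow> real. (\<Sum>i\<in>I. \<Sum>j\<in>I. v i * M i j * v j) \<ge> 0)"

end

theory Submission imports Defs begin

text \<open>Pairing with the coefficients \<open>b\<^sub>\<alpha>\<close> of \<open>\<B>\<close> is a linear functional on forms of degree
  \<open>2 k\<close>, and its value at the square of a form \<open>q = \<Sum> q\<^sub>\<beta> x\<^sup>\<beta>\<close> of degree \<open>k\<close> is
  \<open>\<Sum> q\<^sub>\<beta> q\<^sub>\<gamma> b\<^bsub>\<beta>+\<gamma>\<^esub>\<close>: this is the quadratic form of the moment matrix at the coefficient
  vector of \<open>q\<close> (lemma \<open>coeff_pairing_square\<close>). If the matrix is positive semidefinite, the
  functional is nonnegative on squares, hence on sums of squares. Conversely, every vector is the
  coefficient vector of some \<open>q\<close>, and the square of that \<open>q\<close> is the polynomial of a symmetric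
  tensor, because every form is (lemma \<open>ex_sym_tensor_poly\<close>); so membership in the dual cone
  tests the quadratic form at every vector.\<close>

section \<open>Exponents of index tuples\<close>

definition exponent :: "nat list \<Rightarrow> multi_index" where
  "exponent is = (\<Sum>i\<leftarrow>is. Poly_Mapping.single i 1)"

lemma lookup_exponent: "Poly_Mapping.lookup (exponent is) i = count (mset is) i"
  by (induction "is") (auto simp: exponent_def lookup_add lookup_single when_def)

lemma exponent_eq_iff: "exponent is = exponent js \<longleftrightarrow> mset is = mset js"
  by (simp add: poly_mapping_eq_iff lookup_exponent fun_eq_iff multiset_eq_iff)

lemma finite_tensor_indices: "finite (tensor_indices m n)"
  using finite_lists_length_eq[of "{..<n}" m]
  by (simp add: tensor_indices_def conj_commute)

lemma multi_indices_eq_exponents: "multi_indices n m = exponent ` tensor_indices m n"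
proof (intro equalityI subsetI)
  fix \<alpha> assume "\<alpha> \<in> multi_indices n m"
  then have keys: "Poly_Mapping.keys \<alpha> \<subseteq> {..<n}"
    and deg: "(\<Sum>i<n. Poly_Mapping.lookup \<alpha> i) = m"
    by (auto simp: multi_indices_def)
  \<comment> \<open>A multi-index is the multiplicity function of a finite multiset; any enumeration of that
    multiset is a tuple with this exponent.\<close>
  have fin: "finite {i. 0 < Poly_Mapping.lookup \<alpha> i}"
    using finite_lookup[of \<alpha>] by simp
  obtain "is" where "mset is = Abs_multiset (Poly_Mapping.lookup \<alpha>)"
    using ex_mset by blast
  then have cnt: "count (mset is) = Poly_Mapping.lookup \<alpha>"
    by (simp add: fin)
  have "set is = Poly_Mapping.keys \<alpha>"
    by (metis cnt count_eq_zero_iff in_keys_iff set_mset_mset subsetI subset_antisym)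
  moreover have "length is = (\<Sum>i<n. count (mset is) i)"
    by (metis calculation keys finite_lessThan set_mset_mset size_mset size_multiset_overloaded_eq
        sum.mono_neutral_left count_eq_zero_iff DiffD2)
  ultimately have "is \<in> tensor_indices m n"
    using keys deg cnt by (simp add: tensor_indices_def)
  moreover have "exponent is = \<alpha>"
    by (simp add: poly_mapping_eq_iff lookup_exponent fun_eq_iff cnt)
  ultimately show "\<alpha> \<in> exponent ` tensor_indices m n" by blast
next
  fix \<alpha> assume "\<alpha> \<in> exponent ` tensor_indices m n"
  then obtain "is" where \<alpha>: "\<alpha> = exponent is" and len: "length is = m" and sub: "set is \<subseteq> {..<n}"
    by (auto simp: tensor_indices_def)
  have "Poly_Mapping.keys \<alpha> = set is"
    by (auto simp: \<alpha> in_keys_iff lookup_exponent)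
  moreover have "(\<Sum>i<n. count (mset is) i) = (\<Sum>i\<in>set is. count (mset is) i)"
    using sub by (intro sum.mono_neutral_right) auto
  then have "(\<Sum>i<n. count (mset is) i) = length is"
    by (metis set_mset_mset size_mset size_multiset_overloaded_eq)
  ultimately show "\<alpha> \<in> multi_indices n m"
    using sub len by (simp add: multi_indices_def \<alpha> lookup_exponent)
qed

lemma finite_multi_indices: "finite (multi_indices n d)"
  by (simp add: multi_indices_eq_exponents finite_tensor_indices)

lemma multi_indices_add:
  assumes "\<beta> \<in> multi_indices n d" and "\<gamma> \<in> multi_indices n e"
  shows "\<beta> + \<gamma> \<in> multi_indices n (d + e)"
  using assms keys_add[of \<beta> \<gamma>]
  by (auto simp: multi_indices_def lookup_add sum.distrib)

section \<open>Every form is the polynomial of a symmetric tensor\<close>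

lemma lookup_sum: "Poly_Mapping.lookup (\<Sum>x\<in>S. f x) a = (\<Sum>x\<in>S. Poly_Mapping.lookup (f x) a)"
  by (induction S rule: infinite_finite_induct) (auto simp: lookup_add)

lemma tensor_coeff_eq_sum:
  "tensor_coeff m n A \<alpha> = (\<Sum>is | is \<in> tensor_indices m n \<and> exponent is = \<alpha>. A is)"
  by (simp add: tensor_coeff_def tensor_poly_def lookup_sum lookup_single when_def
      sum.inter_filter finite_tensor_indices exponent_def)

text \<open>The coefficient of each monomial is distributed evenly over the index tuples with that
  exponent; these tuples are the rearrangements of one of them, so the tensor is symmetric.\<close>

lemma ex_sym_tensor_poly:
  assumes "homogeneous_poly n m p"
  shows "\<exists>A \<in> sym_tensors m n. tensor_poly m n A = p"
proof -
  define F where "F \<alpha> = {is \<in> tensor_indices m n. exponent is = \<alpha>}" for \<alpha>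
  define A where "A is = (if is \<in> tensor_indices m n
    then Poly_Mapping.lookup p (exponent is) / real (card (F (exponent is))) else 0)" for "is"
  have "A \<in> sym_tensors m n"
    by (auto simp: sym_tensors_def A_def simp flip: exponent_eq_iff)
  moreover have "tensor_poly m n A = p"
  proof (rule poly_mapping_eqI)
    fix \<alpha>
    have "Poly_Mapping.lookup (tensor_poly m n A) \<alpha> = (\<Sum>is\<in>F \<alpha>. A is)"
      using tensor_coeff_eq_sum[of m n A \<alpha>] by (simp add: tensor_coeff_def F_def)
    also have "\<dots> = (\<Sum>is\<in>F \<alpha>. Poly_Mapping.lookup p \<alpha> / real (card (F \<alpha>)))"
      by (intro sum.cong) (auto simp: F_def A_def)
    also have "\<dots> = Poly_Mapping.lookup p \<alpha>"
    proof (cases "F \<alpha> = {}")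
      case True
      \<comment> \<open>No tuple has exponent \<open>\<alpha>\<close>, so \<open>\<alpha>\<close> has the wrong degree or the wrong variables.\<close>
      then have "\<alpha> \<notin> multi_indices n m"
        by (auto simp: F_def multi_indices_eq_exponents)
      then have "Poly_Mapping.lookup p \<alpha> = 0"
        using assms by (auto simp: homogeneous_poly_def in_keys_iff)
      with True show ?thesis by simp
    next
      case False
      moreover have "finite (F \<alpha>)"
        by (simp add: F_def finite_tensor_indices)
      ultimately show ?thesis by simp
    qed
    finally show "Poly_Mapping.lookup (tensor_poly m n A) \<alpha> = Poly_Mapping.lookup p \<alpha>" .
  qed
  ultimately show ?thesis by blast
qed

section \<open>The functional defined by a coefficient vector\<close>

definition coeff_pairing :: "nat \<Rightarrow> nat \<Rightarrow> (multi_index \<Rightarrow> real) \<Rightarrow> real_mpoly \<Rightarrow> real" where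
  "coeff_pairing n d b p = (\<Sum>\<alpha>\<in>multi_indices n d. Poly_Mapping.lookup p \<alpha> * b \<alpha>)"

lemma tensor_inner_eq_coeff_pairing:
  "tensor_inner m n A B = coeff_pairing n m (tensor_coeff m n B) (tensor_poly m n A)"
  by (simp add: tensor_inner_def coeff_pairing_def tensor_coeff_def)

lemma coeff_pairing_zero: "coeff_pairing n d b 0 = 0"
  by (simp add: coeff_pairing_def)

lemma coeff_pairing_add:
  "coeff_pairing n d b (p + q) = coeff_pairing n d b p + coeff_pairing n d b q"
  by (simp add: coeff_pairing_def lookup_add distrib_right sum.distrib)

lemma coeff_pairing_sum:
  "coeff_pairing n d b (\<Sum>x\<in>S. f x) = (\<Sum>x\<in>S. coeff_pairing n d b (f x))"
  by (induction S rule: infinite_finite_induct)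
    (simp_all add: coeff_pairing_zero coeff_pairing_add)

lemma coeff_pairing_sum_list:
  "coeff_pairing n d b (\<Sum>x\<leftarrow>xs. f x) = (\<Sum>x\<leftarrow>xs. coeff_pairing n d b (f x))"
  by (induction xs) (simp_all add: coeff_pairing_zero coeff_pairing_add)

lemma coeff_pairing_single:
  assumes "\<alpha> \<in> multi_indices n d"
  shows "coeff_pairing n d b (Poly_Mapping.single \<alpha> c) = c * b \<alpha>"
proof -
  have "coeff_pairing n d b (Poly_Mapping.single \<alpha> c)
      = (\<Sum>\<beta>\<in>multi_indices n d. if \<alpha> = \<beta> then c * b \<beta> else 0)"
    unfolding coeff_pairing_def by (intro sum.cong) (auto simp: lookup_single when_def)
  also have "\<dots> = c * b \<alpha>"
    using assms by (simp add: finite_multi_indices)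
  finally show ?thesis .
qed

lemma homogeneous_poly_eq_sum:
  assumes "homogeneous_poly n d q"
  shows "q = (\<Sum>\<beta>\<in>multi_indices n d. Poly_Mapping.single \<beta> (Poly_Mapping.lookup q \<beta>))"
  using assms
  by (intro poly_mapping_eqI)
    (auto simp: lookup_sum lookup_single when_def finite_multi_indices homogeneous_poly_def
      in_keys_iff)

lemma homogeneous_poly_mult:
  assumes "homogeneous_poly n d p" and "homogeneous_poly n e q"
  shows "homogeneous_poly n (d + e) (p * q)"
  using assms keys_mult[of p q] multi_indices_add[of _ n d _ e]
  unfolding homogeneous_poly_def by blast

text \<open>Squaring a form adds exponents in pairs, which is exactly the index pattern of the moment
  matrix.\<close>

lemma coeff_pairing_square:
  assumes "homogeneous_poly n k q"
  shows "coeff_pairing n (2 * k) b (q\<^sup>2) =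
    (\<Sum>\<beta>\<in>multi_indices n k. \<Sum>\<gamma>\<in>multi_indices n k.
      Poly_Mapping.lookup q \<beta> * b (\<beta> + \<gamma>) * Poly_Mapping.lookup q \<gamma>)"
proof -
  let ?I = "multi_indices n k"
  let ?c = "Poly_Mapping.lookup q"
  have "q\<^sup>2 = (\<Sum>\<beta>\<in>?I. Poly_Mapping.single \<beta> (?c \<beta>)) * (\<Sum>\<gamma>\<in>?I. Poly_Mapping.single \<gamma> (?c \<gamma>))"
    using homogeneous_poly_eq_sum[OF assms] by (simp add: power2_eq_square)
  then have "q\<^sup>2 = (\<Sum>\<beta>\<in>?I. \<Sum>\<gamma>\<in>?I. Poly_Mapping.single (\<beta> + \<gamma>) (?c \<beta> * ?c \<gamma>))"
    by (simp add: sum_product mult_single)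
  then have "coeff_pairing n (2 * k) b (q\<^sup>2) =
      (\<Sum>\<beta>\<in>?I. \<Sum>\<gamma>\<in>?I. coeff_pairing n (2 * k) b (Poly_Mapping.single (\<beta> + \<gamma>) (?c \<beta> * ?c \<gamma>)))"
    by (simp add: coeff_pairing_sum)
  also have "\<dots> = (\<Sum>\<beta>\<in>?I. \<Sum>\<gamma>\<in>?I. ?c \<beta> * b (\<beta> + \<gamma>) * ?c \<gamma>)"
  proof (intro sum.cong refl)
    fix \<beta> \<gamma> assume "\<beta> \<in> ?I" "\<gamma> \<in> ?I"
    then have "\<beta> + \<gamma> \<in> multi_indices n (2 * k)"
      using multi_indices_add[of \<beta> n k \<gamma> k] by (simp add: mult_2)
    then show "coeff_pairing n (2 * k) b (Poly_Mapping.single (\<beta> + \<gamma>) (?c \<beta> * ?c \<gamma>))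
        = ?c \<beta> * b (\<beta> + \<gamma>) * ?c \<gamma>"
      by (simp add: coeff_pairing_single)
  qed
  finally show ?thesis .
qed

section \<open>The dual cone and the moment matrix\<close>

theorem proposition6p1:
  fixes m n k :: nat and B :: real_tensor
  assumes "m \<ge> 2" and "n \<ge> 2" and "m = 2 * k"
    and "B \<in> sym_tensors m n"
  shows "B \<in> SOS_dual m n \<longleftrightarrow> psd_on (multi_indices n k) (moment_matrix m n B)"
proof
  let ?I = "multi_indices n k"
  let ?M = "moment_matrix m n B"
  let ?L = "coeff_pairing n m (tensor_coeff m n B)"
  have square: "?L (q\<^sup>2) =
      (\<Sum>\<beta>\<in>?I. \<Sum>\<gamma>\<in>?I. Poly_Mapping.lookup q \<beta> * ?M \<beta> \<gamma> * Poly_Mapping.lookup q \<gamma>)"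
    if "homogeneous_poly n k q" for q
    using coeff_pairing_square[OF that] assms(3) by (simp add: moment_matrix_def)
  show "psd_on ?I ?M" if B: "B \<in> SOS_dual m n"
    unfolding psd_on_def
  proof (intro conjI allI ballI)
    show "?M \<beta> \<gamma> = ?M \<gamma> \<beta>" for \<beta> \<gamma>
      by (simp add: moment_matrix_def add.commute)
  next
    fix v :: "multi_index \<Rightarrow> real"
    define q where "q = (\<Sum>\<beta>\<in>?I. Poly_Mapping.single \<beta> (v \<beta>))"
    have lookup_q: "Poly_Mapping.lookup q \<beta> = (if \<beta> \<in> ?I then v \<beta> else 0)" for \<beta>
      by (simp add: q_def lookup_sum lookup_single when_def finite_multi_indices)
    then have q: "homogeneous_poly n k q"
      by (auto simp: homogeneous_poly_def in_keys_iff split: if_splits)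
    then have "homogeneous_poly n m (q\<^sup>2)"
      using homogeneous_poly_mult[OF q q] assms(3) by (simp add: power2_eq_square mult_2)
    then obtain A where A: "A \<in> sym_tensors m n" "tensor_poly m n A = q\<^sup>2"
      using ex_sym_tensor_poly by blast
    then have "A \<in> SOS m n"
      unfolding SOS_def using q assms(3) by (auto intro!: exI[of _ "[q]"])
    then have "0 \<le> ?L (q\<^sup>2)"
      using B A(2) by (auto simp: SOS_dual_def tensor_inner_eq_coeff_pairing)
    also have "\<dots> = (\<Sum>\<beta>\<in>?I. \<Sum>\<gamma>\<in>?I. v \<beta> * ?M \<beta> \<gamma> * v \<gamma>)"
      unfolding square[OF q] by (intro sum.cong) (auto simp: lookup_q)
    finally show "0 \<le> (\<Sum>\<beta>\<in>?I. \<Sum>\<gamma>\<in>?I. v \<beta> * ?M \<beta> \<gamma> * v \<gamma>)" .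
  qed
  show "B \<in> SOS_dual m n" if psd: "psd_on ?I ?M"
    unfolding SOS_dual_def
  proof (intro CollectI conjI ballI)
    fix A assume "A \<in> SOS m n"
    then obtain qs where qs: "\<forall>q\<in>set qs. homogeneous_poly n k q"
      and A: "tensor_poly m n A = (\<Sum>q\<leftarrow>qs. q\<^sup>2)"
      using assms(3) by (auto simp: SOS_def)
    have "0 \<le> ?L (q\<^sup>2)" if "q \<in> set qs" for q
      using psd qs that by (simp add: square psd_on_def)
    then show "0 \<le> tensor_inner m n A B"
      by (auto simp: tensor_inner_eq_coeff_pairing A coeff_pairing_sum_list intro!: sum_list_nonneg)
  qed (fact assms(4))
qed

end
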